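(* Let $n\ge1$ be an integer. Suppose that $M:[0,\infty)\to[0,\infty)$ satisfies condition (M) with constants $d_M\ge2$ and $D_M>\max\{2,e+2-n\}$. Let $u\in C_0^1(\mathbb{R}^n)$. Denoting $$\mathcal{K}^{(n)}=\int_{\mathbb{R}^n}M(|x|\,|u(x)|)\,d\gamma_n(x),\quad \mathcal{L}^{(n)}=\int_{\mathbb{R}^n}M(|u(x)|)\,d\gamma_n(x),\quad \mathcal{M}^{(n)}=\int_{\mathbb{R}^n}M(|\nabla u(x)|)\,d\gamma_n(x),$$ one has $$\mathcal{K}^{(n)}\le\left(\frac12D_M\left(\mathcal{M}^{(n)}\right)^{1/D_M}+\sqrt{\frac14D_M^2\left(\mathcal{M}^{(n)}\right)^{2/D_M}+(D_M+n-2)\left(\mathcal{L}^{(n)}\right)^{2/D_M}}\right)^{D_M}.$$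
   Context: Condition (M), for a function $M:[0,\infty)\to[0,\infty)$ and constants $d_M,D_M>0$: $M$ is nonconstant, $M(ar)\le a^{D_M}M(r)$ for all $r\ge0$, $a\ge1$, and $M(ar)\le a^{d_M}M(r)$ for all $r\ge0$, $a\in(0,1)$. The measure $\gamma_n$ is the standard Gaussian measure on $\mathbb{R}^n$, $\gamma_n(dx)=(2\pi)^{-n/2}e^{-|x|^2/2}\,dx$. $C_0^1(\mathbb{R}^n)$ denotes the compactly supported real-valued $C^1$ functions on $\mathbb{R}^n$. Here $e$ is Euler's number. *)

theory Defs
  imports "HOL-Analysis.Analysis"
begin

(* A function M : [0,oo) -> [0,oo) is represented by M :: real => real, of which only the
   values on [0,oo) are constrained or used.  The powers are of positive reals a, so powr
   is the usual real power. *)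
definition condition_M :: "(real \<Rightarrow> real) \<Rightarrow> real \<Rightarrow> real \<Rightarrow> bool" where
  "condition_M M d D \<longleftrightarrow>
     0 < d \<and> 0 < D \<and>
     (\<forall>r\<ge>0. 0 \<le> M r) \<and>
     (\<exists>r\<ge>0. \<exists>s\<ge>0. M r \<noteq> M s) \<and>
     (\<forall>r\<ge>0. \<forall>a\<ge>1. M (a * r) \<le> a powr D * M r) \<and>
     (\<forall>r\<ge>0. \<forall>a. 0 < a \<and> a < 1 \<longrightarrow> M (a * r) \<le> a powr d * M r)"

definition std_gaussian :: "(real ^ 'n) measure" where
  "std_gaussian = density lborel
     (\<lambda>x. ennreal ((2 * pi) powr (- real CARD('n) / 2) * exp (- (norm x)\<^sup>2 / 2)))"

definition grad :: "(real ^ 'n \<Rightarrow> real) \<Rightarrow> real ^ 'n \<Rightarrow> real ^ 'n" where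
  "grad u x = (THE D. GDERIV u x :> D)"

definition C01 :: "(real ^ 'n \<Rightarrow> real) set" where
  "C01 = {u. (\<forall>x. u differentiable (at x)) \<and> continuous_on UNIV (grad u) \<and>
             compact (closure {x. u x \<noteq> 0})}"

lemma grad_eqI: "GDERIV u x :> D \<Longrightarrow> grad u x = D"
  unfolding grad_def
proof (rule the_equality)
  fix E assume "GDERIV u x :> D" "GDERIV u x :> E"
  then have "(\<lambda>h. h \<bullet> D) = (\<lambda>h. h \<bullet> E)"
    unfolding gderiv_def by (rule has_derivative_unique)
  then have "\<forall>h. h \<bullet> D = h \<bullet> E"
    by (simp add: fun_eq_iff)
  then have "D = E"
    by (simp only: vector_eq_ldot)
  then show "E = D"
    by simp
qed

lemma GDERIV_grad:
  assumes "u differentiable (at x)"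
  shows "GDERIV u x :> grad u x"
proof -
  obtain f' where f': "(u has_derivative f') (at x)"
    using assms unfolding differentiable_def by blast
  then have "linear f'"
    by (rule has_derivative_linear)
  then have "f' = (\<lambda>h. h \<bullet> adjoint f' 1)"
    by (simp add: fun_eq_iff adjoint_works)
  then have "GDERIV u x :> adjoint f' 1"
    using f' unfolding gderiv_def by simp
  then show ?thesis
    by (simp add: grad_eqI)
qed

end

theory Submission
  imports Defs
begin

text \<open>
  Write \<open>a x = \<bar>x\<bar> \<bar>u x\<bar>\<close>, \<open>E = D + n - 2\<close> and \<open>\<rho> x = exp (- \<bar>x\<bar>\<^sup>2 / 2)\<close>.  Integrating the divergence of the
  vector field \<open>x \<mapsto> M (a x) x / \<bar>x\<bar>\<^sup>2\<close> against the Gaussian measure, and using \<open>r M' r \<le> D M r\<close>, gives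
    \<open>\<integral> M (a) d\<gamma> \<le> E \<integral> M (a) / \<bar>x\<bar>\<^sup>2 d\<gamma> + D \<integral> (M (a) / a) \<bar>\<nabla>u\<bar> d\<gamma>\<close>.
  Since \<open>M\<close> is only locally Lipschitz, this is proved without differentiating \<open>M\<close>, by comparing the
  integral of \<open>\<rho> M (a) / \<bar>x\<bar>\<^sup>2\<close> with itself after the dilation \<open>x \<mapsto> (1 + h) x\<close> and letting \<open>h\<close> tend to
  0 from above (\<open>gaussian_dilation_inequality\<close>).

  Both integrals on the right have the form \<open>\<integral> M (a) (b / a) ^ p d\<gamma>\<close>: with \<open>b = \<bar>u\<bar>\<close>, \<open>p = 2\<close> and with
  \<open>b = \<bar>\<nabla>u\<bar>\<close>, \<open>p = 1\<close>.  If \<open>M r\<close> were the power \<open>r ^ D\<close>, Hoelder's inequality would bound this by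
  \<open>(\<integral> M (a))^(1 - p/D) (\<integral> M (b))^(p/D)\<close>, and the \<open>D\<close>-th roots \<open>k, l, m\<close> of the three integrals in the
  theorem would satisfy \<open>k\<^sup>2 \<le> E l\<^sup>2 + D m k\<close>; solving this quadratic inequality for \<open>k\<close> is exactly the
  claim.  For general \<open>M\<close> the same argument needs
  \<open>M b \<ge> (b / a)^D M a\<close>, which can fail where \<open>a < b\<close>.  What survives is the pointwise Young inequality with a scale (\<open>condition_M_interpolation\<close>), valid for scales \<open>\<lambda>\<close> with
  \<open>\<lambda>^(D - p) \<le> p / D\<close>.  If the claim were false, scales slightly larger than \<open>l / k\<close> and
  \<open>m / k\<close> would satisfy \<open>E \<lambda>\<^sup>2 + D \<mu> < 1\<close>, and the scaled inequalities would add up to \<open>k^D < k^D\<close>.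
  Admissibility of these scales is where \<open>E > e\<close> enters: \<open>\<lambda>\<^sup>2 < 1 / e\<close> gives
  \<open>\<lambda>^(D - 2) \<le> exp (- (D/2 - 1)) \<le> 2 / D\<close> (\<open>scale_admissible_2\<close>).
\<close>

section \<open>Growth functions\<close>

lemma condition_M_nonneg: "condition_M M d D \<Longrightarrow> 0 \<le> r \<Longrightarrow> 0 \<le> M r"
  by (simp add: condition_M_def)

lemma condition_M_upscale: "condition_M M d D \<Longrightarrow> 0 \<le> r \<Longrightarrow> 1 \<le> a \<Longrightarrow> M (a * r) \<le> a powr D * M r"
  by (simp add: condition_M_def)

lemma condition_M_downscale:
  assumes "condition_M M d D" "0 \<le> r" "0 < a" "a \<le> 1"
  shows "M (a * r) \<le> a powr d * M r"
  using assms by (cases "a = 1") (auto simp: condition_M_def)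

lemma condition_M_zero:
  assumes "condition_M M d D"
  shows "M 0 = 0"
proof -
  have "M (1/2 * 0) \<le> (1/2) powr d * M 0"
    using condition_M_downscale[OF assms, of 0 "1/2"] by simp
  moreover have "(1/2::real) powr d < 1"
    using assms powr_less_mono2_neg[of "-d" "1" "2"] by (simp add: condition_M_def powr_divide powr_minus)
  ultimately have "M 0 \<le> 0"
    using condition_M_nonneg[OF assms, of 0]
    by (smt (verit) mult_cancel_right1 mult_less_cancel_right mult_zero_right)
  then show ?thesis
    using condition_M_nonneg[OF assms, of 0] by simp
qed

text \<open>
  Because \<open>d \<ge> 2\<close>, the function \<open>M r / r\<^sup>2\<close> stays bounded near 0.  This is what makes
  \<open>M (\<bar>x\<bar> \<bar>u x\<bar>) / \<bar>x\<bar>\<^sup>2\<close> integrable near the origin in every dimension.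
\<close>

lemma condition_M_quadratic:
  assumes M: "condition_M M d D" and "2 \<le> d" "0 \<le> r" "r \<le> S" "0 < S"
  shows "M r \<le> (r / S)\<^sup>2 * M S"
proof (cases "r = 0")
  case False
  then have q: "0 < r / S" "r / S \<le> 1"
    using assms by auto
  have "M r = M (r / S * S)"
    using assms by simp
  also have "\<dots> \<le> (r / S) powr d * M S"
    using condition_M_downscale[OF M _ q, of S] assms by simp
  also have "\<dots> \<le> (r / S) powr 2 * M S"
    using q \<open>2 \<le> d\<close> \<open>0 < S\<close> condition_M_nonneg[OF M, of S]
    by (intro mult_right_mono powr_mono') auto
  finally show ?thesis
    using q by simp
qed (simp add: condition_M_zero[OF M])

lemma condition_M_mono:
  assumes M: "condition_M M d D" and "2 \<le> d" and rs: "0 \<le> r" "r \<le> s"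
  shows "M r \<le> M s"
proof (cases "s = 0")
  case False
  then have "M r \<le> (r / s)\<^sup>2 * M s"
    using condition_M_quadratic[OF M \<open>2 \<le> d\<close> rs] rs by simp
  also have "\<dots> \<le> 1 * M s"
    using rs False condition_M_nonneg[OF M, of s]
    by (intro mult_right_mono) (auto simp: power_le_one)
  finally show ?thesis by simp
qed (use rs in auto)

lemma powr_tangent_at_1:
  fixes y p :: real
  assumes "0 \<le> y" "1 \<le> p"
  shows "1 + p * (y - 1) \<le> y powr p"
proof (cases "y = 0")
  case False
  have "(y powr p) powr (1/p) * 1 powr (1 - 1/p) \<le> 1/p * y powr p + (1 - 1/p) * 1"
    using assms False by (intro Youngs_inequality_0) (auto simp: field_simps)
  then have "y \<le> 1/p * y powr p + (1 - 1/p)"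
    using assms False by (simp add: powr_powr)
  from mult_left_mono[OF this, of p] show ?thesis
    using assms by (simp add: algebra_simps)
qed (use assms in simp)

text \<open>
  The finite-difference form of \<open>r M' r \<le> D M r\<close>: condition (M) gives \<open>(a / c)^D M c \<le> M a\<close>, and
  Bernoulli's inequality bounds \<open>1 - (a / c)^D\<close> by \<open>D (1 - a / c)\<close>.  Having the quotient \<open>M c / c\<close> at the
  larger point keeps the bound valid at \<open>a = 0\<close>.
\<close>

lemma condition_M_increment:
  assumes M: "condition_M M d D" and "1 \<le> D" and "0 \<le> a" "a \<le> c"
  shows "M c - M a \<le> D * (M c / c) * (c - a)"
proof (cases "a = 0")
  case True
  then show ?thesis
    using assms condition_M_zero[OF M] condition_M_nonneg[OF M, of c]
      mult_right_mono[of 1 D "M c"] by simp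
next
  case False
  then have pos: "0 < a" "0 < c"
    using assms by auto
  have "M c = M (c / a * a)"
    using pos by simp
  also have "\<dots> \<le> (c / a) powr D * M a"
    using condition_M_upscale[OF M, of a "c / a"] assms pos by simp
  finally have "(a / c) powr D * M c \<le> (a / c) powr D * ((c / a) powr D * M a)"
    by (intro mult_left_mono) auto
  also have "\<dots> = M a"
    using pos by (simp add: powr_divide)
  finally have "(a / c) powr D * M c \<le> M a" .
  moreover have "(1 + D * (a / c - 1)) * M c \<le> (a / c) powr D * M c"
    using powr_tangent_at_1[of "a / c" D] assms pos condition_M_nonneg[OF M, of c]
    by (intro mult_right_mono) auto
  ultimately have "M c - M a \<le> D * (1 - a / c) * M c"
    by (simp add: algebra_simps)
  also have "\<dots> = D * (M c / c) * (c - a)"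
    using pos by (simp add: field_simps)
  finally show ?thesis .
qed

lemma condition_M_quotient_linear:
  assumes M: "condition_M M d D" and "2 \<le> d" "0 \<le> r" "r \<le> S" "0 < S"
  shows "M r / r \<le> r * (M S / S\<^sup>2)"
proof (cases "r = 0")
  case False
  have "M r / r \<le> ((r / S)\<^sup>2 * M S) / r"
    using condition_M_quadratic[OF assms] \<open>0 \<le> r\<close> by (intro divide_right_mono) auto
  then show ?thesis
    using False by (simp add: power2_eq_square)
qed simp

lemma condition_M_continuous:
  assumes M: "condition_M M d D" and "2 \<le> d" "1 \<le> D"
  shows "continuous_on {0..} M"
proof -
  have lip: "\<bar>M y - M x\<bar> \<le> D * (M S / S) * \<bar>y - x\<bar>"
    if "0 \<le> x" "0 \<le> y" "x \<le> S" "y \<le> S" "0 < S" for x y S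
  proof -
    have *: "M c - M a \<le> D * (M S / S) * (c - a)" if "0 \<le> a" "a \<le> c" "c \<le> S" for a c
    proof -
      have "M c / c \<le> c * (M S / S\<^sup>2)"
        using condition_M_quotient_linear[OF M \<open>2 \<le> d\<close>, of c S] that \<open>0 < S\<close> by auto
      also have "\<dots> \<le> S * (M S / S\<^sup>2)"
        using condition_M_nonneg[OF M, of S] that \<open>0 < S\<close> by (intro mult_right_mono) auto
      also have "\<dots> = M S / S"
        using \<open>0 < S\<close> by (simp add: power2_eq_square)
      finally have "D * (M c / c) * (c - a) \<le> D * (M S / S) * (c - a)"
        using that \<open>1 \<le> D\<close> by (intro mult_right_mono mult_left_mono) auto
      then show ?thesis
        using condition_M_increment[OF M \<open>1 \<le> D\<close> that(1,2)] by linarith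
    qed
    show ?thesis
    proof (cases "x \<le> y")
      case True
      then show ?thesis
        using *[of x y] condition_M_mono[OF M \<open>2 \<le> d\<close>, of x y] that by simp
    next
      case False
      then show ?thesis
        using *[of y x] condition_M_mono[OF M \<open>2 \<le> d\<close>, of y x] that by simp
    qed
  qed
  show ?thesis
    unfolding continuous_on_def
  proof
    fix x :: real assume "x \<in> {0..}"
    then have x: "0 \<le> x" by simp
    let ?S = "x + 1"
    have "((\<lambda>y. D * (M ?S / ?S) * \<bar>y - x\<bar>) \<longlongrightarrow> D * (M ?S / ?S) * \<bar>x - x\<bar>) (at x within {0..})"
      by (intro tendsto_intros)
    then have "((\<lambda>y. D * (M ?S / ?S) * \<bar>y - x\<bar>) \<longlongrightarrow> 0) (at x within {0..})"
      by simp
    moreover have "eventually (\<lambda>y. \<bar>M y - M x\<bar> \<le> D * (M ?S / ?S) * \<bar>y - x\<bar>) (at x within {0..})"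
    proof -
      have "eventually (\<lambda>y. y < x + 1) (at x within {0..})"
        by (rule order_tendstoD(2)[OF tendsto_ident_at]) simp
      moreover have "eventually (\<lambda>y. y \<in> {0..}) (at x within {0..})"
        by (auto simp: eventually_at_filter)
      ultimately show ?thesis
        by eventually_elim (use x in \<open>intro lip, auto\<close>)
    qed
    ultimately have "((\<lambda>y. M y - M x) \<longlongrightarrow> 0) (at x within {0..})"
      by (auto intro: Lim_null_comparison[where g = "\<lambda>y. D * (M ?S / ?S) * \<bar>y - x\<bar>"])
    then show "(M \<longlongrightarrow> M x) (at x within {0..})"
      using Lim_null by blast
  qed
qed

text \<open>
  The point \<open>r = 0\<close> is included: there the quotient is 0 by the convention on division, which agrees
  with its limit because \<open>M r / r\<close> is at most a multiple of \<open>r\<close>.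
\<close>

lemma condition_M_quotient_continuous:
  assumes M: "condition_M M d D" and "2 \<le> d" "1 \<le> D"
  shows "continuous_on {0..} (\<lambda>r. M r / r)"
  unfolding continuous_on_def
proof
  fix x :: real assume "x \<in> {0..}"
  then have x: "0 \<le> x" by simp
  show "((\<lambda>r. M r / r) \<longlongrightarrow> M x / x) (at x within {0..})"
  proof (cases "x = 0")
    case True
    have "eventually (\<lambda>y. y < x + 1) (at x within {0..})"
      by (rule order_tendstoD(2)[OF tendsto_ident_at]) simp
    moreover have "eventually (\<lambda>y. y \<in> {0..}) (at x within {0..})"
      by (auto simp: eventually_at_filter)
    ultimately have "eventually (\<lambda>r. norm (M r / r) \<le> r * (M 1 / 1\<^sup>2)) (at x within {0..})"
    proof eventually_elim
      case (elim r)
      then show ?case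
        using condition_M_quotient_linear[OF M \<open>2 \<le> d\<close>, of r 1] condition_M_nonneg[OF M, of r] True
        by simp
    qed
    moreover have "((\<lambda>r. r * (M 1 / 1\<^sup>2)) \<longlongrightarrow> x * (M 1 / 1\<^sup>2)) (at x within {0..})"
      by (intro tendsto_intros)
    ultimately have "((\<lambda>r. M r / r) \<longlongrightarrow> 0) (at x within {0..})"
      using True by (auto intro: Lim_null_comparison[where g = "\<lambda>r. r * (M 1 / 1\<^sup>2)"])
    then show ?thesis
      using True by simp
  next
    case False
    then show ?thesis
      using condition_M_continuous[OF assms] x
      by (intro tendsto_intros) (auto simp: continuous_on_def)
  qed
qed

lemma condition_M_measurable:
  assumes M: "condition_M M d D" and "2 \<le> d"
    and f[measurable]: "f \<in> borel_measurable N" and "\<And>x. 0 \<le> f x"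
  shows "(\<lambda>x. M (f x)) \<in> borel_measurable N"
proof -
  have "mono (\<lambda>r. M (max 0 r))"
    by (intro monoI condition_M_mono[OF M \<open>2 \<le> d\<close>]) auto
  then have [measurable]: "(\<lambda>r. M (max 0 r)) \<in> borel_measurable borel"
    by (rule borel_measurable_mono)
  have "(\<lambda>x. M (max 0 (f x))) \<in> borel_measurable N"
    by measurable
  then show ?thesis
    using assms(4) by (simp add: max_absorb2)
qed

section \<open>A Young inequality with a scale\<close>

text \<open>
  Put \<open>z = b / a\<close>.  Where \<open>b \<le> a\<close>, condition (M) gives \<open>M b \<ge> z^D M a\<close>, so the claim is Young's
  inequality \<open>y^p \<le> (1 - p/D) + (p/D) y^D\<close> at \<open>y = z / l\<close>.  Where \<open>b > a\<close> the exponent \<open>d \<ge> p\<close>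
  gives \<open>M a (b / a)^p \<le> M b\<close>, and the restriction on \<open>l\<close> says precisely that the coefficient of
  \<open>M b\<close> on the right is at least 1.
\<close>

lemma condition_M_interpolation:
  assumes M: "condition_M M d D" and p: "0 < p" "p \<le> d" "p \<le> D"
    and l: "0 < l" "l powr (D - p) \<le> p / D" and ab: "0 \<le> a" "0 \<le> b"
  shows "M a * (b / a) powr p \<le> (1 - p / D) * l powr p * M a + (p / D) * l powr (p - D) * M b"
proof (cases "a = 0 \<or> b = 0")
  case True
  then have "M a * (b / a) powr p = 0"
    using condition_M_zero[OF M] by auto
  moreover have "0 \<le> (1 - p / D) * l powr p * M a" "0 \<le> (p / D) * l powr (p - D) * M b"
    using p condition_M_nonneg[OF M] ab by simp_all
  ultimately show ?thesis
    by linarith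
next
  case False
  then have pos: "0 < a" "0 < b" using ab by auto
  have D: "0 < D" using p by auto
  note nn = condition_M_nonneg[OF M]
  show ?thesis
  proof (cases "b \<le> a")
    case True
    define z where "z = b / a"
    have z: "0 < z" "z \<le> 1" using pos True by (auto simp: z_def)
    have "M a = M ((a / b) * b)" using pos by simp
    also have "\<dots> \<le> (a / b) powr D * M b"
      using condition_M_upscale[OF M, of b "a / b"] pos True by simp
    finally have "z powr D * M a \<le> z powr D * ((a / b) powr D * M b)"
      by (intro mult_left_mono) auto
    then have *: "z powr D * M a \<le> M b"
      using pos by (simp add: z_def powr_divide)
    have "((z / l) powr D) powr (p / D) * 1 powr (1 - p / D) \<le> p / D * (z / l) powr D + (1 - p / D) * 1"
      using p D z l by (intro Youngs_inequality_0) (auto simp: field_simps)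
    then have "(z / l) powr p \<le> p / D * (z / l) powr D + (1 - p / D)"
      using D by (simp add: powr_powr)
    then have "l powr p * (z / l) powr p \<le> l powr p * (p / D * (z / l) powr D + (1 - p / D))"
      by (intro mult_left_mono) auto
    then have "z powr p \<le> (1 - p / D) * l powr p + p / D * l powr (p - D) * z powr D"
      using l by (simp add: powr_divide powr_diff field_simps)
    then have "z powr p * M a \<le> ((1 - p / D) * l powr p + p / D * l powr (p - D) * z powr D) * M a"
      using nn[of a] pos by (intro mult_right_mono) auto
    also have "\<dots> = (1 - p / D) * l powr p * M a + p / D * l powr (p - D) * (z powr D * M a)"
      by (simp add: algebra_simps)
    also have "\<dots> \<le> (1 - p / D) * l powr p * M a + p / D * l powr (p - D) * M b"
      using * p by (intro add_left_mono mult_left_mono) auto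
    finally show ?thesis
      by (simp add: z_def mult.commute)
  next
    case False
    have "M a = M ((a / b) * b)" using pos by simp
    also have "\<dots> \<le> (a / b) powr d * M b"
      using condition_M_downscale[OF M, of b "a / b"] pos False by simp
    also have "\<dots> \<le> (a / b) powr p * M b"
      using pos False p nn[of b] by (intro mult_right_mono powr_mono') auto
    finally have "M a * (b / a) powr p \<le> ((a / b) powr p * M b) * (b / a) powr p"
      by (intro mult_right_mono) auto
    also have "\<dots> = M b"
      using pos by (simp add: powr_divide)
    also have "\<dots> \<le> (p / D) * l powr (p - D) * M b"
    proof -
      have "1 = l powr (D - p) * l powr (p - D)"
        using l by (simp flip: powr_add)
      also have "\<dots> \<le> p / D * l powr (p - D)"
        using l by (intro mult_right_mono) auto
      finally show ?thesis
        using mult_right_mono[of 1 "p / D * l powr (p - D)" "M b"] nn[of b] pos by simp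
    qed
    also have "\<dots> \<le> (1 - p / D) * l powr p * M a + (p / D) * l powr (p - D) * M b"
      using p nn[of a] pos by simp
    finally show ?thesis .
  qed
qed

section \<open>Integration by parts through dilations\<close>

lemma integrable_bounded_support:
  fixes f :: "'a::euclidean_space \<Rightarrow> real"
  assumes "f \<in> borel_measurable borel" "\<And>x. 0 \<le> f x"
    and "\<And>x. norm x \<le> R \<Longrightarrow> f x \<le> B" "\<And>x. R < norm x \<Longrightarrow> f x = 0"
  shows "integrable lborel f"
proof (rule integrableI_bounded_set[where A = "cball 0 R" and B = B])
  show "emeasure lborel (cball (0::'a) R) < \<infinity>"
    by (rule emeasure_lborel_cball_finite)
qed (use assms in auto)

lemma integrable_gaussian_weighted:
  fixes f :: "'a::euclidean_space \<Rightarrow> real"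
  assumes M: "condition_M M d D" "2 \<le> d" and [measurable]: "f \<in> borel_measurable borel"
    and f: "\<And>x. 0 \<le> f x" "\<And>x. f x \<le> F" "\<And>x. R < norm x \<Longrightarrow> f x = 0"
  shows "integrable lborel (\<lambda>x. exp (- (norm x)\<^sup>2 / 2) * M (f x))"
proof (rule integrable_bounded_support[where R = R and B = "1 * M F"])
  note nn = condition_M_nonneg[OF M(1) f(1)]
  have [measurable]: "(\<lambda>x. M (f x)) \<in> borel_measurable borel"
    by (rule condition_M_measurable[OF M]) (use f(1) in auto)
  show "(\<lambda>x. exp (- (norm x)\<^sup>2 / 2) * M (f x)) \<in> borel_measurable borel"
    by measurable
  show "0 \<le> exp (- (norm x)\<^sup>2 / 2) * M (f x)" for x
    using nn by simp
  show "exp (- (norm x)\<^sup>2 / 2) * M (f x) \<le> 1 * M F" for x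
    using nn condition_M_mono[OF M f(1) f(2)] by (intro mult_mono) auto
  show "exp (- (norm x)\<^sup>2 / 2) * M (f x) = 0" if "R < norm x" for x
    using f(3)[OF that] condition_M_zero[OF M(1)] by simp
qed

lemma lborel_integral_dilation:
  fixes h :: "'a::euclidean_space \<Rightarrow> real"
  assumes [measurable]: "h \<in> borel_measurable borel" and t: "0 < t"
  shows "(\<integral>x. h x \<partial>lborel) = t ^ DIM('a) * (\<integral>x. h (t *\<^sub>R x) \<partial>lborel)"
proof -
  have "(\<integral>x. h x \<partial>lborel) =
      (\<integral>x. h x \<partial>density (distr lborel borel (\<lambda>x. 0 + t *\<^sub>R x)) (\<lambda>_. ennreal (\<bar>t\<bar> ^ DIM('a))))"
    using t by (subst lborel_affine[of t 0]) auto
  also have "\<dots> = (\<integral>x. t ^ DIM('a) * h x \<partial>distr lborel borel (\<lambda>x. 0 + t *\<^sub>R x))"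
    using t by (subst integral_density) auto
  also have "\<dots> = (\<integral>x. t ^ DIM('a) * h (t *\<^sub>R x) \<partial>lborel)"
    by (subst integral_distr) auto
  finally show ?thesis
    by simp
qed

lemma GDERIV_radial:
  assumes "GDERIV u x :> D"
  shows "((\<lambda>h. (u ((1 + h) *\<^sub>R x) - u x) / h) \<longlongrightarrow> x \<bullet> D) (at 0)"
proof -
  have "((\<lambda>h. (1 + h) *\<^sub>R x) has_derivative (\<lambda>h. h *\<^sub>R x)) (at 0)"
    by (auto intro!: derivative_eq_intros)
  moreover have "(u has_derivative (\<lambda>h. h \<bullet> D)) (at ((1 + 0) *\<^sub>R x))"
    using assms by (simp add: gderiv_def)
  ultimately have "((\<lambda>h. u ((1 + h) *\<^sub>R x)) has_derivative (\<lambda>h. (h *\<^sub>R x) \<bullet> D)) (at 0)"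
    by (rule has_derivative_compose[where g = u])
  then have "((\<lambda>h. u ((1 + h) *\<^sub>R x)) has_real_derivative (x \<bullet> D)) (at 0)"
    by (simp add: has_field_derivative_def mult_commute_abs)
  then show ?thesis
    by (simp add: DERIV_def)
qed

lemma C1_bounded_support_bounds:
  fixes u :: "'a::euclidean_space \<Rightarrow> real"
  assumes du: "\<And>x. GDERIV u x :> g x" and g: "continuous_on UNIV g"
    and supp: "\<And>x. R < norm x \<Longrightarrow> u x = 0" "0 < R"
  obtains U G where "0 \<le> U" "0 \<le> G" "\<And>x. \<bar>u x\<bar> \<le> U" "\<And>x. norm (g x) \<le> G"
    "\<And>x. R < norm x \<Longrightarrow> g x = 0"
    "\<And>x y. \<bar>u y - u x\<bar> \<le> G * norm (y - x)"
proof -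
  have g0: "g x = 0" if "R < norm x" for x
  proof -
    have "open {y::'a. R < norm y}"
      by (intro open_Collect_less continuous_intros)
    then have "((\<lambda>_. 0) has_derivative (\<lambda>h. h \<bullet> g x)) (at x)"
    proof (rule has_derivative_transform_within_open[where f = u, rotated])
      show "(u has_derivative (\<lambda>h. h \<bullet> g x)) (at x)"
        using du[of x] by (simp add: gderiv_def)
    qed (use that supp(1) in auto)
    then have "(\<lambda>h. h \<bullet> g x) = (\<lambda>_. 0)"
      by (rule has_derivative_unique) (rule has_derivative_const)
    then have "g x \<bullet> g x = 0"
      by meson
    then show ?thesis by simp
  qed
  have cu: "continuous_on UNIV u"
    using du by (meson continuous_at_imp_continuous_on gderiv_def has_derivative_continuous)
  have "bounded (u ` cball 0 R)" "bounded (g ` cball 0 R)"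
    using cu g by (auto intro!: compact_imp_bounded compact_continuous_image
      intro: continuous_on_subset)
  then obtain U G where "0 < U" "0 < G" "\<And>x. norm x \<le> R \<Longrightarrow> norm (u x) \<le> U"
      "\<And>x. norm x \<le> R \<Longrightarrow> norm (g x) \<le> G"
    by (auto simp: bounded_pos)
  then have U: "0 \<le> U" "\<And>x. \<bar>u x\<bar> \<le> U" and G: "0 \<le> G" "\<And>x. norm (g x) \<le> G"
    using supp(1) g0 by (auto simp: not_le[symmetric]) (metis abs_zero less_eq_real_def linorder_not_le norm_zero)+
  have "\<bar>u y - u x\<bar> \<le> G * norm (y - x)" for x y
  proof -
    have "norm (u y - u x) \<le> G * norm (y - x)"
    proof (rule differentiable_bound[where S = UNIV and f' = "\<lambda>z h. h \<bullet> g z"])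
      show "onorm (\<lambda>h. h \<bullet> g z) \<le> G" for z
      proof (rule onorm_le)
        show "norm (h \<bullet> g z) \<le> G * norm h" for h
          using Cauchy_Schwarz_ineq2[of h "g z"] mult_left_mono[OF G(2)[of z], of "norm h"]
          by (simp add: mult.commute)
      qed
    qed (use du in \<open>auto simp: gderiv_def\<close>)
    then show ?thesis by simp
  qed
  then show ?thesis
    using that U G g0 by blast
qed

lemma powr_difference_quotient: "((\<lambda>h. ((1 + h) powr E - 1) / h) \<longlongrightarrow> (E::real)) (at 0)"
proof -
  have "((\<lambda>h. (1 + h) powr E) has_real_derivative E) (at 0)"
    by (auto intro!: derivative_eq_intros)
  then show ?thesis
    by (simp add: DERIV_def)
qed

text \<open>
  To first order in \<open>h\<close> the dilated weight is \<open>(1 - h \<bar>x\<bar>\<^sup>2)\<close> times the weight.  The bound comes from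
  \<open>1 - exp (- z) \<ge> z exp (- z)\<close> at \<open>z = h \<bar>x\<bar>\<^sup>2\<close>; replacing \<open>exp (- z)\<close> by its minimum on the ball makes
  the error factor independent of \<open>x\<close>, so that it can be taken out of the integral.
\<close>

lemma gaussian_weight_dilation:
  fixes x :: "'a::real_normed_vector"
  assumes "0 < h" "norm x \<le> R"
  shows "exp (- (norm ((1 + h) *\<^sub>R x))\<^sup>2 / 2)
    \<le> exp (- (norm x)\<^sup>2 / 2) * (1 - h * exp (- (h * R\<^sup>2)) * (norm x)\<^sup>2)"
proof -
  define z where "z = h * (norm x)\<^sup>2"
  have z: "0 \<le> z" "z \<le> h * R\<^sup>2"
    using assms by (auto simp: z_def power_mono)
  have "(norm ((1 + h) *\<^sub>R x))\<^sup>2 = (1 + h)\<^sup>2 * (norm x)\<^sup>2"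
    by (simp only: norm_scaleR power_mult_distrib power2_abs)
  also have "\<dots> = (norm x)\<^sup>2 + 2 * z + h\<^sup>2 * (norm x)\<^sup>2"
    by (simp add: z_def power2_eq_square algebra_simps)
  finally have "(norm x)\<^sup>2 / 2 + z \<le> (norm ((1 + h) *\<^sub>R x))\<^sup>2 / 2"
    by simp
  then have "exp (- (norm ((1 + h) *\<^sub>R x))\<^sup>2 / 2) \<le> exp (- (norm x)\<^sup>2 / 2 + - z)"
    by simp
  also have "\<dots> = exp (- (norm x)\<^sup>2 / 2) * exp (- z)"
    by (rule exp_add)
  also have "exp (- z) \<le> 1 - z * exp (- z)"
    using mult_right_mono[OF exp_ge_add_one_self[of z], of "exp (- z)"]
    by (simp add: algebra_simps flip: exp_add)
  also have "\<dots> \<le> 1 - z * exp (- (h * R\<^sup>2))"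
    using z by (simp add: mult_left_mono)
  finally show ?thesis
    by (simp add: z_def mult_ac)
qed

text \<open>
  Let \<open>H = \<rho> M (a) / \<bar>x\<bar>\<^sup>2\<close> and \<open>t = 1 + h\<close>.  The integral of \<open>H\<close> equals \<open>t^n\<close> times the integral of
  \<open>H (t x)\<close>, and \<open>H (t x)\<close> is bounded pointwise through three changes: the factor \<open>t\<close> leaves \<open>M\<close> at the
  cost of \<open>t^D\<close>, the increment of \<open>\<bar>u\<bar>\<close> is controlled by \<open>condition_M_increment\<close>, and the weight by
  \<open>gaussian_weight_dilation\<close>.  After division by \<open>h\<close> these yield, as \<open>h\<close> tends to 0, the terms with
  \<open>D + n - 2\<close>, with the gradient, and with the left-hand side, respectively.  Only the gradient term
  depends on \<open>h\<close> inside the integral and requires dominated convergence.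
\<close>

lemma gaussian_dilation_inequality:
  fixes u :: "'a::euclidean_space \<Rightarrow> real"
  assumes M: "condition_M M d D" and dD: "2 \<le> d" "1 \<le> D"
    and du: "\<And>x. GDERIV u x :> g x" and g: "continuous_on UNIV g"
    and supp: "\<And>x. R < norm x \<Longrightarrow> u x = 0" "0 < R"
  defines "\<rho> \<equiv> \<lambda>x::'a. exp (- (norm x)\<^sup>2 / 2)"
    and "a \<equiv> \<lambda>x::'a. norm x * \<bar>u x\<bar>"
  shows "(\<integral>x. \<rho> x * M (a x) \<partial>lborel) \<le>
      (D + real DIM('a) - 2) * (\<integral>x. \<rho> x * (M (a x) / (norm x)\<^sup>2) \<partial>lborel)
      + D * (\<integral>x. \<rho> x * (M (a x) / a x * norm (g x)) \<partial>lborel)"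
proof -
  obtain U G where U: "0 \<le> U" "\<And>x. \<bar>u x\<bar> \<le> U" and G: "0 \<le> G" "\<And>x. norm (g x) \<le> G"
    and g0: "\<And>x. R < norm x \<Longrightarrow> g x = 0" and lip: "\<And>x y. \<bar>u y - u x\<bar> \<le> G * norm (y - x)"
    using C1_bounded_support_bounds[OF du g supp] by metis
  have "continuous_on UNIV u"
    using du by (meson continuous_at_imp_continuous_on gderiv_def has_derivative_continuous)
  then have [measurable]: "u \<in> borel_measurable borel" "g \<in> borel_measurable borel"
    using g by (auto intro: borel_measurable_continuous_onI)
  have [measurable]: "\<rho> \<in> borel_measurable borel" "a \<in> borel_measurable borel"
    unfolding \<rho>_def a_def by measurable
  have \<rho>: "0 < \<rho> x" "\<rho> x \<le> 1" for x
    by (auto simp: \<rho>_def)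
  have a: "0 \<le> a x" for x
    by (simp add: a_def)
  have a0: "a x = 0" if "R < norm x" for x
    using supp that by (simp add: a_def)
  note nn = condition_M_nonneg[OF M] and M0 = condition_M_zero[OF M]
    and mono = condition_M_mono[OF M dD(1)]
  have [measurable]: "(\<lambda>x. M (f x)) \<in> borel_measurable borel"
    if "f \<in> borel_measurable borel" "\<And>x. 0 \<le> f x" for f :: "'a \<Rightarrow> real"
    using condition_M_measurable[OF M dD(1)] that .

  \<comment> \<open>On the ball of radius \<open>R\<close>, \<open>a\<close> and its perturbation \<open>s h\<close> are at most \<open>3 U R\<close>; the summand 1 makes \<open>S\<close> positive.\<close>
  define S where "S = 3 * U * R + 1"
  define N where "N = M S / S\<^sup>2"
  have S: "0 < S" using U supp by (simp add: S_def add_nonneg_pos)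
  have N: "0 \<le> N" using nn[of S] S by (simp add: N_def)
  have Mq: "M r \<le> r\<^sup>2 * N" if "0 \<le> r" "r \<le> S" for r
    using condition_M_quadratic[OF M dD(1) that S] by (simp add: N_def power_divide)
  have Ml: "M r / r \<le> r * N" if "0 \<le> r" "r \<le> S" for r
    using condition_M_quotient_linear[OF M dD(1) that S] by (simp add: N_def)
  have aR: "a x \<le> U * norm x" for x
    using mult_left_mono[OF U(2)[of x], of "norm x"] by (simp add: a_def mult.commute)
  have aS: "a x \<le> S" if "norm x \<le> R" for x
  proof -
    have "a x \<le> U * R"
      using aR[of x] mult_left_mono[OF that U(1)] by linarith
    then show ?thesis
      using mult_nonneg_nonneg[of U R] U(1) supp(2) unfolding S_def by linarith
  qed

  define e where "e h x = \<bar>u ((1 + h) *\<^sub>R x) - u x\<bar>" for h x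
  define s where "s h x = a x + norm x * e h x" for h x
  have [measurable]: "e h \<in> borel_measurable borel" "s h \<in> borel_measurable borel" for h
    unfolding e_def[abs_def] s_def[abs_def] by measurable
  have e: "0 \<le> e h x" "e h x \<le> 2 * U" for h x
    using U(2)[of x] U(2)[of "(1 + h) *\<^sub>R x"] by (auto simp: e_def)
  have eG: "e h x \<le> h * (G * norm x)" if "0 < h" for h x
    using lip[of "(1 + h) *\<^sub>R x" x] that by (simp add: e_def algebra_simps)
  have s: "0 \<le> s h x" "a x \<le> s h x" "s h x \<le> 3 * U * norm x" for h x
    using a[of x] e[of h x] aR[of x] mult_left_mono[OF e(2)[of h x], of "norm x"]
    by (auto simp: s_def algebra_simps)
  have sS: "s h x \<le> S" if "norm x \<le> R" for x h
    using s(3)[of h x] mult_left_mono[OF that, of "3 * U"] U(1) by (simp add: S_def)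

  \<comment> \<open>\<open>B h\<close> is the gradient term at step \<open>h\<close>, and \<open>B\<^sub>0\<close> its limit.\<close>
  define B where "B h x = \<rho> x * (M (s h x) / s h x) * (e h x / h / norm x)" for h x
  define B\<^sub>0 where "B\<^sub>0 x = \<rho> x * (M (a x) / a x) * (\<bar>x \<bullet> g x\<bar> / norm x)" for x
  define H where "H x = \<rho> x * (M (a x) / (norm x)\<^sup>2)" for x
  have [measurable]: "B h \<in> borel_measurable borel" for h
    unfolding B_def[abs_def] using s by measurable
  have [measurable]: "B\<^sub>0 \<in> borel_measurable borel" "H \<in> borel_measurable borel"
    unfolding B\<^sub>0_def[abs_def] H_def[abs_def] using a by measurable

  have Hint: "integrable lborel H"
  proof (rule integrable_bounded_support[where R = R and B = "1 * (U\<^sup>2 * N)"])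
    fix x :: 'a assume x: "norm x \<le> R"
    show "H x \<le> 1 * (U\<^sup>2 * N)"
    proof (cases "x = 0")
      case False
      have "M (a x) \<le> (a x)\<^sup>2 * N"
        using Mq[OF a aS[OF x]] .
      also have "\<dots> \<le> (U * norm x)\<^sup>2 * N"
        using aR a N by (intro mult_right_mono power_mono) auto
      finally have "M (a x) / (norm x)\<^sup>2 \<le> U\<^sup>2 * N"
        using False by (simp add: divide_simps power_mult_distrib mult_ac)
      then show ?thesis
        unfolding H_def using \<rho>[of x] nn[OF a[of x]] by (intro mult_mono) auto
    qed (use N in \<open>simp add: H_def\<close>)
  next
    show "0 \<le> H x" for x
      using \<rho>(1)[of x] nn[OF a[of x]] by (simp add: H_def)
  qed (auto simp: H_def a0 M0)

  have Kint: "integrable lborel (\<lambda>x. \<rho> x * M (a x))"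
  proof -
    have "a x \<le> S" for x
      using aS[of x] a0[of x] S by (cases "norm x \<le> R") auto
    then show ?thesis
      unfolding \<rho>_def using a0 by (intro integrable_gaussian_weighted[OF M dD(1) _ a]) auto
  qed

  have B0int: "integrable lborel B\<^sub>0" and Gint: "integrable lborel (\<lambda>x. \<rho> x * (M (a x) / a x * norm (g x)))"
    and B0le: "B\<^sub>0 x \<le> \<rho> x * (M (a x) / a x * norm (g x))" for x
  proof -
    have q: "0 \<le> \<rho> x * (M (a x) / a x)" "norm x \<le> R \<Longrightarrow> \<rho> x * (M (a x) / a x) \<le> S * N" for x
    proof -
      assume x: "norm x \<le> R"
      have "M (a x) / a x \<le> S * N"
        using Ml[OF a aS[OF x]] mult_right_mono[OF aS[OF x] N] by linarith
      then have "\<rho> x * (M (a x) / a x) \<le> 1 * (S * N)"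
        using \<rho>[of x] nn[OF a[of x]] a[of x] by (intro mult_mono) auto
      then show "\<rho> x * (M (a x) / a x) \<le> S * N" by simp
    qed (use \<rho>(1)[of x] nn[OF a[of x]] a[of x] in auto)
    have c: "\<bar>x \<bullet> g x\<bar> / norm x \<le> norm (g x)" for x
      using Cauchy_Schwarz_ineq2[of x "g x"] by (cases "x = 0") (auto simp: divide_simps mult.commute)
    show le: "B\<^sub>0 x \<le> \<rho> x * (M (a x) / a x * norm (g x))" for x
      unfolding B\<^sub>0_def using mult_left_mono[OF c q(1), of x x] by (simp add: mult.assoc)
    have le2: "\<rho> x * (M (a x) / a x * norm (g x)) \<le> S * N * G" if "norm x \<le> R" for x
      using mult_mono[OF q(2)[OF that] G(2)[of x]] S N by (simp add: mult.assoc)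
    have nn2: "0 \<le> \<rho> x * (M (a x) / a x * norm (g x))" for x
      using q(1)[of x] mult_nonneg_nonneg[of "\<rho> x * (M (a x) / a x)" "norm (g x)"] by (simp add: mult.assoc)
    have nn3: "0 \<le> B\<^sub>0 x" for x
      unfolding B\<^sub>0_def using q(1)[of x] by (intro mult_nonneg_nonneg[of "\<rho> x * (M (a x) / a x)"]) auto
    show "integrable lborel (\<lambda>x. \<rho> x * (M (a x) / a x * norm (g x)))"
      by (rule integrable_bounded_support[OF _ nn2 le2]) (use a in \<open>auto simp: g0\<close>)
    show "integrable lborel B\<^sub>0"
      by (rule integrable_bounded_support[OF _ nn3 order_trans[OF le le2]]) (measurable, simp add: B\<^sub>0_def g0)
  qed

  have B_bound: "0 \<le> B h x" "B h x \<le> indicator (cball 0 R) x * (3 * U * R * N * G)" if h: "0 < h" for h x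
  proof -
    show "0 \<le> B h x"
      using \<rho>(1)[of x] nn[OF s(1)[of h x]] s(1)[of h x] e(1)[of h x] h by (simp add: B_def)
    show "B h x \<le> indicator (cball 0 R) x * (3 * U * R * N * G)"
    proof (cases "norm x \<le> R")
      case True
      have 1: "M (s h x) / s h x \<le> 3 * U * R * N"
      proof -
        have "M (s h x) / s h x \<le> s h x * N"
          using Ml[OF s(1) sS[OF True]] .
        also have "s h x \<le> 3 * U * R"
          using s(3)[of h x] mult_left_mono[OF True, of "3 * U"] U(1) by linarith
        finally show ?thesis using N by (simp add: mult_right_mono)
      qed
      have 2: "e h x / h / norm x \<le> G"
        using eG[OF h, of x] h G(1) by (cases "x = 0") (auto simp: divide_simps mult_ac)
      have "B h x \<le> 1 * (3 * U * R * N) * G"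
        unfolding B_def using \<rho>[of x] 1 2 nn[OF s(1)[of h x]] s(1)[of h x] e(1)[of h x] h U(1) supp(2) N
        by (intro mult_mono) auto
      then show ?thesis using True by simp
    next
      case False
      then have "R < norm ((1 + h) *\<^sub>R x)"
        using h mult_right_mono[of 1 "1 + h" "norm x"] by simp
      then have "e h x = 0"
        using supp(1) False by (simp add: e_def)
      then show ?thesis
        using False by (simp add: B_def)
    qed
  qed
  have Bint: "integrable lborel (B h)" if h: "0 < h" for h
  proof (rule integrable_bounded_support[where R = R and B = "3 * U * R * N * G"])
    show "B h x \<le> 3 * U * R * N * G" if "norm x \<le> R" for x
      using B_bound(2)[OF h, of x] that by simp
    show "B h x = 0" if "R < norm x" for x
      using B_bound[OF h, of x] that by simp
  qed (use B_bound(1)[OF h] in auto)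

  define K A b E where "K = (\<integral>x. \<rho> x * M (a x) \<partial>lborel)" and "A = (\<integral>x. H x \<partial>lborel)"
    and "b = (\<lambda>h. \<integral>x. B h x \<partial>lborel)" and "E = D + real DIM('a) - 2"

  \<comment> \<open>At \<open>x = 0\<close> all quotients by \<open>norm x\<close> are 0, so the bound holds trivially there.\<close>
  have pointwise: "H ((1 + h) *\<^sub>R x) \<le> (1 + h) powr (D - 2) *
      (H x - h * exp (- (h * R\<^sup>2)) * (\<rho> x * M (a x)) + h * D * B h x)" if h: "0 < h" for h x
  proof (cases "x = 0 \<or> R < norm x")
    case True
    then have "H ((1 + h) *\<^sub>R x) = 0"
    proof
      assume "R < norm x"
      then have "R < norm ((1 + h) *\<^sub>R x)"
        using h mult_right_mono[of 1 "1 + h" "norm x"] by simp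
      then show ?thesis
        by (simp add: H_def a0 M0)
    qed (simp add: H_def)
    moreover have "H x = 0" "M (a x) = 0"
      using True a0[of x] M0 by (auto simp: H_def a_def)
    ultimately show ?thesis
      using B_bound(1)[OF h, of x] h dD by simp
  next
    case False
    let ?t = "1 + h"
    have t: "1 \<le> ?t" using h by simp
    have x: "0 < norm x" "norm x \<le> R" using False by auto
    have s2: "a x \<le> s h x" by (rule s)
    let ?c = "norm x * \<bar>u (?t *\<^sub>R x)\<bar>"
    have "a (?t *\<^sub>R x) = ?t * ?c"
      using h by (simp add: a_def)
    then have "M (a (?t *\<^sub>R x)) \<le> ?t powr D * M ?c"
      using condition_M_upscale[OF M, of ?c ?t] t by simp
    also have "M ?c \<le> M (s h x)"
    proof (rule mono)
      show "?c \<le> s h x"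
        unfolding s_def a_def e_def distrib_left[symmetric] by (intro mult_left_mono) auto
    qed simp
    also have "M (s h x) \<le> M (a x) + D * (M (s h x) / s h x) * (norm x * e h x)"
      using condition_M_increment[OF M dD(2) a[of x] s2] by (simp add: s_def)
    finally have 1: "M (a (?t *\<^sub>R x)) \<le> ?t powr D * (M (a x) + D * (M (s h x) / s h x) * (norm x * e h x))"
      by (simp add: mult_left_mono)
    let ?J = "D * (M (s h x) / s h x) * (norm x * e h x)"
    have J: "0 \<le> ?J"
      using dD nn[OF s(1)[of h x]] s(1)[of h x] e(1)[of h x] by simp
    have 2: "\<rho> (?t *\<^sub>R x) \<le> \<rho> x * (1 - h * exp (- (h * R\<^sup>2)) * (norm x)\<^sup>2)"
      unfolding \<rho>_def by (rule gaussian_weight_dilation[OF h x(2)])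
    \<comment> \<open>For the gradient term, already of order \<open>h\<close>, this cruder bound suffices.\<close>
    have 3: "\<rho> (?t *\<^sub>R x) \<le> \<rho> x"
    proof -
      have "\<rho> x * (1 - h * exp (- (h * R\<^sup>2)) * (norm x)\<^sup>2) \<le> \<rho> x * 1"
        using \<rho>(1)[of x] h by (intro mult_left_mono) auto
      then show ?thesis using 2 by simp
    qed
    have "H (?t *\<^sub>R x) = \<rho> (?t *\<^sub>R x) * M (a (?t *\<^sub>R x)) / (?t\<^sup>2 * (norm x)\<^sup>2)"
      using h by (simp add: H_def power_mult_distrib)
    also have "\<dots> \<le> \<rho> (?t *\<^sub>R x) * (?t powr D * (M (a x) + ?J)) / (?t\<^sup>2 * (norm x)\<^sup>2)"
      using 1 \<rho>(1)[of "?t *\<^sub>R x"] by (intro divide_right_mono mult_left_mono) auto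
    also have "\<dots> = ?t powr (D - 2) * ((\<rho> (?t *\<^sub>R x) * M (a x) + \<rho> (?t *\<^sub>R x) * ?J) / (norm x)\<^sup>2)"
      using h x by (simp add: powr_diff field_simps)
    also have "\<dots> \<le> ?t powr (D - 2) *
        ((\<rho> x * (1 - h * exp (- (h * R\<^sup>2)) * (norm x)\<^sup>2) * M (a x) + \<rho> x * ?J) / (norm x)\<^sup>2)"
      using mult_right_mono[OF 2 nn[OF a[of x]]] mult_right_mono[OF 3 J]
      by (intro mult_left_mono divide_right_mono add_mono) auto
    also have "(\<rho> x * (1 - h * exp (- (h * R\<^sup>2)) * (norm x)\<^sup>2) * M (a x) + \<rho> x * ?J) / (norm x)\<^sup>2
        = H x - h * exp (- (h * R\<^sup>2)) * (\<rho> x * M (a x)) + h * D * B h x"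
    proof -
      have "\<rho> x * ?J / (norm x)\<^sup>2 = h * D * B h x"
        using x h by (simp add: B_def power2_eq_square)
      moreover have "\<rho> x * (1 - h * exp (- (h * R\<^sup>2)) * (norm x)\<^sup>2) * M (a x) / (norm x)\<^sup>2
        = H x - h * exp (- (h * R\<^sup>2)) * (\<rho> x * M (a x))"
        using x by (simp add: H_def field_simps)
      ultimately show ?thesis
        by (simp only: add_divide_distrib)
    qed
    finally show ?thesis .
  qed

  have integrated: "(1 + h) powr E * exp (- (h * R\<^sup>2)) * K
      \<le> ((1 + h) powr E - 1) / h * A + (1 + h) powr E * (D * b h)" if h: "0 < h" for h
  proof -
    let ?t = "1 + h"
    let ?F = "\<lambda>x. H x - h * exp (- (h * R\<^sup>2)) * (\<rho> x * M (a x)) + h * D * B h x"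
    have Fint: "integrable lborel ?F"
      using Hint Kint Bint[OF h] by simp
    have "integrable lborel (\<lambda>x. H (?t *\<^sub>R x))"
    proof (rule Bochner_Integration.integrable_bound[of lborel "\<lambda>x. ?t powr (D - 2) * ?F x"])
      have "norm (H (?t *\<^sub>R x)) \<le> norm (?t powr (D - 2) * ?F x)" for x
      proof -
        have "0 \<le> H (?t *\<^sub>R x)"
          using \<rho>(1)[of "?t *\<^sub>R x"] nn[OF a[of "?t *\<^sub>R x"]] by (simp add: H_def)
        then show ?thesis
          using pointwise[OF h, of x] unfolding real_norm_def by linarith
      qed
      then show "AE x in lborel. norm (H (?t *\<^sub>R x)) \<le> norm (?t powr (D - 2) * ?F x)"
        by simp
    qed (use Fint in auto)
    then have "(\<integral>x. H (?t *\<^sub>R x) \<partial>lborel) \<le> (\<integral>x. ?t powr (D - 2) * ?F x \<partial>lborel)"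
      using Fint pointwise[OF h] by (intro integral_mono) auto
    also have "\<dots> = ?t powr (D - 2) * (A - h * exp (- (h * R\<^sup>2)) * K + h * D * b h)"
      using Hint Kint Bint[OF h] by (simp add: A_def K_def b_def)
    finally have "?t ^ DIM('a) * (\<integral>x. H (?t *\<^sub>R x) \<partial>lborel)
      \<le> ?t ^ DIM('a) * (?t powr (D - 2) * (A - h * exp (- (h * R\<^sup>2)) * K + h * D * b h))"
      using h by (intro mult_left_mono) auto
    also have "\<dots> = ?t powr E * (A - h * exp (- (h * R\<^sup>2)) * K + h * D * b h)"
      using h by (simp add: E_def powr_add powr_diff powr_realpow field_simps)
    also have "?t ^ DIM('a) * (\<integral>x. H (?t *\<^sub>R x) \<partial>lborel) = A"
      unfolding A_def using h by (subst lborel_integral_dilation[of H ?t]) auto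
    finally have *: "A \<le> ?t powr E * (A - h * exp (- (h * R\<^sup>2)) * K + h * D * b h)" .
    have "h * (?t powr E * exp (- (h * R\<^sup>2)) * K)
        \<le> (?t powr E - 1) * A + h * (?t powr E * (D * b h))"
      using * by (simp add: algebra_simps)
    also have "\<dots> = h * ((?t powr E - 1) / h * A + ?t powr E * (D * b h))"
      using h by (simp add: distrib_left)
    finally show ?thesis
      using h by simp
  qed

  define X where "X k = inverse (real (Suc k))" for k
  have X: "0 < X k" for k by (simp add: X_def)
  have X0: "X \<longlonglongrightarrow> 0"
    unfolding X_def by (rule LIMSEQ_inverse_real_of_nat)
  then have Xat: "filterlim X (at 0) sequentially"
    using X by (intro filterlim_atI) (auto simp: less_imp_neq[symmetric])

  have b_lim: "(\<lambda>k. b (X k)) \<longlonglongrightarrow> (\<integral>x. B\<^sub>0 x \<partial>lborel)"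
    unfolding b_def
  proof (rule integral_dominated_convergence[where w = "\<lambda>x. indicator (cball 0 R) x * (3 * U * R * N * G)"])
    show "integrable lborel (\<lambda>x::'a. indicator (cball 0 R) x * (3 * U * R * N * G))"
      by (intro integrable_mult_left integrable_real_indicator emeasure_lborel_cball_finite) simp
    show "AE x in lborel. norm (B (X k) x) \<le> indicator (cball 0 R) x * (3 * U * R * N * G)" for k
      using B_bound[OF X[of k]] by auto
    have "(\<lambda>k. B (X k) x) \<longlonglongrightarrow> B\<^sub>0 x" for x
    proof -
      have dq: "(\<lambda>k. (u ((1 + X k) *\<^sub>R x) - u x) / X k) \<longlonglongrightarrow> x \<bullet> g x"
        using filterlim_compose[OF GDERIV_radial[OF du] Xat] .
      have "(\<lambda>k. \<bar>(u ((1 + X k) *\<^sub>R x) - u x) / X k\<bar> / norm x) \<longlonglongrightarrow> \<bar>x \<bullet> g x\<bar> / norm x"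
        using tendsto_divide[OF tendsto_rabs[OF dq] tendsto_const[of "norm x"]] by (cases "x = 0") simp_all
      then have 1: "(\<lambda>k. e (X k) x / X k / norm x) \<longlonglongrightarrow> \<bar>x \<bullet> g x\<bar> / norm x"
        using X by (simp add: e_def abs_divide less_imp_le)
      have "(\<lambda>k. X k * \<bar>(u ((1 + X k) *\<^sub>R x) - u x) / X k\<bar>) \<longlonglongrightarrow> 0 * \<bar>x \<bullet> g x\<bar>"
        by (intro tendsto_mult tendsto_rabs dq X0)
      then have "(\<lambda>k. e (X k) x) \<longlonglongrightarrow> 0"
        using X by (simp add: e_def abs_divide less_imp_neq[symmetric] less_imp_le)
      then have "(\<lambda>k. s (X k) x) \<longlonglongrightarrow> a x + norm x * 0"
        unfolding s_def by (intro tendsto_intros)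
      then have 2: "(\<lambda>k. M (s (X k) x) / s (X k) x) \<longlonglongrightarrow> M (a x) / a x"
        using continuous_on_tendsto_compose[OF condition_M_quotient_continuous[OF M dD], of "\<lambda>k. s (X k) x" "a x"]
          s(1) a by simp
      show ?thesis
        unfolding B_def B\<^sub>0_def by (intro tendsto_mult tendsto_const 1 2)
    qed
    then show "AE x in lborel. (\<lambda>k. B (X k) x) \<longlonglongrightarrow> B\<^sub>0 x"
      by simp
  qed auto
  have E_lim: "(\<lambda>k. ((1 + X k) powr E - 1) / X k) \<longlonglongrightarrow> E"
    using filterlim_compose[OF powr_difference_quotient Xat] .
  have t_lim: "(\<lambda>k. (1 + X k) powr E) \<longlonglongrightarrow> (1 + 0) powr E"
    by (intro tendsto_intros X0) auto
  have exp_lim: "(\<lambda>k. exp (- (X k * R\<^sup>2))) \<longlonglongrightarrow> exp (- (0 * R\<^sup>2))"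
    by (intro tendsto_intros X0)
  have "(\<lambda>k. (1 + X k) powr E * exp (- (X k * R\<^sup>2)) * K) \<longlonglongrightarrow> (1 + 0) powr E * exp (- (0 * R\<^sup>2)) * K"
    by (intro tendsto_mult tendsto_const t_lim exp_lim)
  moreover have "(\<lambda>k. ((1 + X k) powr E - 1) / X k * A + (1 + X k) powr E * (D * b (X k)))
       \<longlonglongrightarrow> E * A + (1 + 0) powr E * (D * (\<integral>x. B\<^sub>0 x \<partial>lborel))"
    by (intro tendsto_mult tendsto_add tendsto_const E_lim t_lim b_lim)
  ultimately have "(1 + 0) powr E * exp (- (0 * R\<^sup>2)) * K \<le> E * A + (1 + 0) powr E * (D * (\<integral>x. B\<^sub>0 x \<partial>lborel))"
    using integrated[OF X] by (intro LIMSEQ_le) auto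
  then have "K \<le> E * A + D * (\<integral>x. B\<^sub>0 x \<partial>lborel)"
    by simp
  also have "\<dots> \<le> E * A + D * (\<integral>x. \<rho> x * (M (a x) / a x * norm (g x)) \<partial>lborel)"
    using dD by (intro add_left_mono mult_left_mono integral_mono B0int Gint B0le) auto
  finally show ?thesis
    unfolding K_def E_def A_def H_def .
qed

section \<open>Optimising the scales\<close>

text \<open>
  With \<open>l\<^sup>2 < 1 / e\<close> one has \<open>ln l < - 1/2\<close>, so the claim follows from \<open>ln (D / 2) \<le> D / 2 - 1\<close>.
  The sharp threshold \<open>(D / 2)^(2 / (D - 2))\<close> for \<open>E\<close> tends to \<open>e\<close> as \<open>D\<close> tends to 2, so \<open>e\<close> is the best
  constant that serves all \<open>D\<close>.
\<close>

lemma scale_admissible_2: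
  fixes D E l :: real
  assumes "2 < D" "exp 1 < E" "0 < l" "E * l\<^sup>2 < 1"
  shows "l powr (D - 2) \<le> 2 / D"
proof -
  have "exp 1 * l\<^sup>2 < 1"
    using assms(2,4) mult_right_mono[of "exp 1" E "l\<^sup>2"] zero_le_power2[of l] by linarith
  then have "ln (exp 1 * l\<^sup>2) < ln 1"
    using assms by (subst ln_less_cancel_iff) auto
  then have "1 + 2 * ln l < 0"
    using assms by (simp add: ln_mult ln_realpow)
  then have "(D - 2) * ln l \<le> (D - 2) * (- 1 / 2)"
    using assms by (intro mult_left_mono) auto
  also have "\<dots> = - (D / 2 - 1)"
    by (simp add: field_simps)
  also have "\<dots> \<le> - ln (D / 2)"
    using ln_le_minus_one[of "D / 2"] assms by simp
  also have "\<dots> = ln (2 / D)"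
    using assms by (simp add: ln_div)
  finally have "exp ((D - 2) * ln l) \<le> exp (ln (2 / D))"
    by simp
  then show ?thesis
    using assms by (simp add: powr_def)
qed

lemma scale_admissible_1:
  fixes D m :: real
  assumes "2 < D" "0 < m" "D * m < 1"
  shows "m powr (D - 1) \<le> 1 / D"
proof -
  have "m < 1 / D"
    using assms by (simp add: field_simps)
  moreover have "1 / D < 1"
    using assms by simp
  ultimately have "m < 1" "m \<le> 1 / D"
    by linarith+
  then have "m powr (D - 1) \<le> m powr 1"
    using assms by (intro powr_mono') auto
  then show ?thesis
    using assms \<open>m \<le> 1 / D\<close> by simp
qed

text \<open>
  Let \<open>k, l\<^sub>0, m\<^sub>0\<close> be the \<open>D\<close>-th roots of \<open>K, L, G\<close>.  If the conclusion failed, \<open>k\<close> would exceed the larger root of the quadratic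
  \<open>k\<^sup>2 = D m\<^sub>0 k + E l\<^sub>0\<^sup>2\<close>, leaving positive slack \<open>q = 1 - E (l\<^sub>0 / k)\<^sup>2 - D (m\<^sub>0 / k)\<close>.  The scales
  \<open>l = l\<^sub>0 / k\<close>, \<open>m = m\<^sub>0 / k\<close> would turn \<open>scaled\<close> into \<open>1 \<le> 1 - q\<close>; part of the slack is spent on enlarging both, so that they
  are positive even if \<open>L\<close> or \<open>G\<close> vanishes.
\<close>

lemma optimise_scales:
  fixes D E K L G :: real
  assumes D: "2 < D" and E: "exp 1 < E" and nn: "0 \<le> K" "0 \<le> L" "0 \<le> G"
    and scaled: "\<And>l m. 0 < l \<Longrightarrow> 0 < m \<Longrightarrow> l powr (D - 2) \<le> 2 / D \<Longrightarrow> m powr (D - 1) \<le> 1 / D \<Longrightarrow>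
      K \<le> E * ((1 - 2 / D) * l\<^sup>2 * K + 2 / D * l powr (2 - D) * L)
        + D * ((1 - 1 / D) * m * K + 1 / D * m powr (1 - D) * G)"
  shows "K \<le> (1/2 * D * G powr (1 / D)
      + sqrt (1/4 * D\<^sup>2 * G powr (2 / D) + E * L powr (2 / D))) powr D"
proof (rule ccontr)
  have E0: "0 < E" using E exp_gt_zero[of 1] by linarith
  define k l\<^sub>0 m\<^sub>0 where "k = K powr (1 / D)" and "l\<^sub>0 = L powr (1 / D)" and "m\<^sub>0 = G powr (1 / D)"
  define T where "T = 1/2 * D * m\<^sub>0 + sqrt (1/4 * D\<^sup>2 * m\<^sub>0\<^sup>2 + E * l\<^sub>0\<^sup>2)"
  have sq: "z powr (2 / D) = (z powr (1 / D))\<^sup>2" for z :: real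
    by (simp add: power2_eq_square flip: powr_add)
  have T0: "0 \<le> T"
    using D E0 by (auto simp: T_def m\<^sub>0_def intro!: add_nonneg_nonneg mult_nonneg_nonneg)
  assume "\<not> ?thesis"
  then have KT: "T powr D < K"
    by (simp add: sq T_def l\<^sub>0_def m\<^sub>0_def)
  then have "(T powr D) powr (1 / D) < k"
    unfolding k_def using D by (intro powr_less_mono2) auto
  then have Tk: "T < k"
    using T0 D by (simp add: powr_powr)
  have K: "0 < K"
    using KT powr_ge_zero[of T D] by linarith
  have k: "0 < k" "k powr D = K"
    using K D by (auto simp: k_def powr_powr)
  have "1/4 * D\<^sup>2 * m\<^sub>0\<^sup>2 + E * l\<^sub>0\<^sup>2 = (sqrt (1/4 * D\<^sup>2 * m\<^sub>0\<^sup>2 + E * l\<^sub>0\<^sup>2))\<^sup>2"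
    using E0 by simp
  also have "\<dots> < (k - 1/2 * D * m\<^sub>0)\<^sup>2"
    using Tk E0 unfolding T_def by (intro power_strict_mono) auto
  finally have quad: "E * l\<^sub>0\<^sup>2 + D * m\<^sub>0 * k < k\<^sup>2"
    by (simp add: power2_eq_square algebra_simps)
  define q where "q = 1 - E * (l\<^sub>0 / k)\<^sup>2 - D * (m\<^sub>0 / k)"
  have "q = (k\<^sup>2 - (E * l\<^sub>0\<^sup>2 + D * m\<^sub>0 * k)) / k\<^sup>2"
    using k by (simp add: q_def field_simps power2_eq_square)
  then have q: "0 < q"
    using quad k by simp
  \<comment> \<open>Each scale takes up a quarter of the slack, which leaves \<open>E l\<^sup>2 + D m = 1 - q / 2\<close>.\<close>
  define m l where "m = m\<^sub>0 / k + q / (4 * D)" and "l = sqrt ((l\<^sub>0 / k)\<^sup>2 + q / (4 * E))"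
  have ml0: "0 \<le> m\<^sub>0 / k" "0 \<le> l\<^sub>0 / k"
    using k by (auto simp: m\<^sub>0_def l\<^sub>0_def)
  have m: "0 < m" "m\<^sub>0 / k \<le> m"
    using q D ml0 by (auto simp: m_def intro: add_nonneg_pos)
  have l2: "l\<^sup>2 = (l\<^sub>0 / k)\<^sup>2 + q / (4 * E)"
    using q E0 by (simp add: l_def)
  have l: "0 < l" "l\<^sub>0 / k \<le> l"
  proof -
    have "0 < (l\<^sub>0 / k)\<^sup>2 + q / (4 * E)"
      using q E0 by (intro add_nonneg_pos) auto
    then show "0 < l" by (simp add: l_def)
    show "l\<^sub>0 / k \<le> l"
      unfolding l_def using q E0 by (intro real_le_rsqrt) simp
  qed
  have sum: "E * l\<^sup>2 + D * m < 1"
  proof -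
    have "E * l\<^sup>2 + D * m = 1 - q / 2"
      using E0 D by (simp add: l2 m_def q_def field_simps)
    then show ?thesis using q by simp
  qed
  have "0 < D * m" "0 < E * l\<^sup>2"
    using m l D E0 by auto
  then have small: "E * l\<^sup>2 < 1" "D * m < 1"
    using sum by linarith+
  \<comment> \<open>A scale at least \<open>(Y / K)^(1/D)\<close> allows \<open>Y\<close> to be traded for \<open>s^D K\<close>.\<close>
  have le_scaled: "s powr (p - D) * Y \<le> s powr p * K"
    if "0 < s" "Y powr (1 / D) / k \<le> s" "0 \<le> Y" for s p Y
  proof -
    have "Y = (Y powr (1 / D) / k) powr D * K"
      using k D that K by (simp add: powr_divide powr_powr)
    also have "\<dots> \<le> s powr D * K"
      using that k K D by (intro mult_right_mono powr_mono2) auto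
    finally have "s powr (p - D) * Y \<le> s powr (p - D) * (s powr D * K)"
      by (intro mult_left_mono) auto
    also have "\<dots> = s powr p * K"
      by (simp flip: powr_add mult.assoc)
    finally show ?thesis .
  qed
  have "l powr (2 - D) * L \<le> l\<^sup>2 * K"
    using le_scaled[of l L 2] l nn by (simp add: l\<^sub>0_def)
  then have 2: "(1 - 2 / D) * l\<^sup>2 * K + 2 / D * l powr (2 - D) * L \<le> l\<^sup>2 * K"
    using mult_left_mono[of "l powr (2 - D) * L" "l\<^sup>2 * K" "2 / D"] D by (simp add: algebra_simps)
  have "m powr (1 - D) * G \<le> m * K"
    using le_scaled[of m G 1] m nn by (simp add: m\<^sub>0_def)
  then have 1: "(1 - 1 / D) * m * K + 1 / D * m powr (1 - D) * G \<le> m * K"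
    using mult_left_mono[of "m powr (1 - D) * G" "m * K" "1 / D"] D by (simp add: algebra_simps)
  have "K \<le> E * ((1 - 2 / D) * l\<^sup>2 * K + 2 / D * l powr (2 - D) * L)
        + D * ((1 - 1 / D) * m * K + 1 / D * m powr (1 - D) * G)"
    using l m small D E by (intro scaled scale_admissible_1 scale_admissible_2) auto
  also have "\<dots> \<le> E * (l\<^sup>2 * K) + D * (m * K)"
    using 1 2 E0 D by (intro add_mono mult_left_mono) auto
  also have "\<dots> = (E * l\<^sup>2 + D * m) * K"
    by (simp add: algebra_simps)
  also have "\<dots> < 1 * K"
    using sum K by (intro mult_strict_right_mono) auto
  finally show False by simp
qed

text \<open>
  The two integrands of \<open>gaussian_dilation_inequality\<close> are \<open>M a (\<bar>u\<bar> / a)\<^sup>2\<close> and \<open>M a (\<bar>\<nabla>u\<bar> / a)\<close>, to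
  which the interpolation inequality applies with \<open>p = 2\<close> and \<open>p = 1\<close>.
\<close>

lemma gaussian_scaled_inequality:
  fixes u :: "'a::euclidean_space \<Rightarrow> real"
  assumes M: "condition_M M d D" and dD: "2 \<le> d" "2 \<le> D"
    and du: "\<And>x. GDERIV u x :> g x" and g: "continuous_on UNIV g"
    and supp: "\<And>x. R < norm x \<Longrightarrow> u x = 0" "0 < R"
    and l: "0 < l" "l powr (D - 2) \<le> 2 / D" and m: "0 < m" "m powr (D - 1) \<le> 1 / D"
  defines "\<rho> \<equiv> \<lambda>x::'a. exp (- (norm x)\<^sup>2 / 2)"
  defines "K \<equiv> (\<integral>x. \<rho> x * M (norm x * \<bar>u x\<bar>) \<partial>lborel)"
    and "L \<equiv> (\<integral>x. \<rho> x * M \<bar>u x\<bar> \<partial>lborel)"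
    and "G \<equiv> (\<integral>x. \<rho> x * M (norm (g x)) \<partial>lborel)"
  shows "K \<le> (D + real DIM('a) - 2) * ((1 - 2 / D) * l\<^sup>2 * K + 2 / D * l powr (2 - D) * L)
        + D * ((1 - 1 / D) * m * K + 1 / D * m powr (1 - D) * G)"
proof -
  obtain U F where U: "0 \<le> U" "\<And>x. \<bar>u x\<bar> \<le> U" and F: "0 \<le> F" "\<And>x. norm (g x) \<le> F"
    and g0: "\<And>x. R < norm x \<Longrightarrow> g x = 0"
    using C1_bounded_support_bounds[OF du g supp] by metis
  have "continuous_on UNIV u"
    using du by (meson continuous_at_imp_continuous_on gderiv_def has_derivative_continuous)
  then have [measurable]: "u \<in> borel_measurable borel" "g \<in> borel_measurable borel"
    using g by (auto intro: borel_measurable_continuous_onI)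
  let ?a = "\<lambda>x. norm x * \<bar>u x\<bar>"
  have \<rho>: "0 \<le> \<rho> x" for x by (simp add: \<rho>_def)
  have aR: "?a x \<le> R * U" for x
  proof (cases "norm x \<le> R")
    case True
    then show ?thesis
      using U(2)[of x] supp(2) by (intro mult_mono) auto
  next
    case False
    then show ?thesis
      using supp U(1) by simp
  qed
  have Kint: "integrable lborel (\<lambda>x. \<rho> x * M (?a x))"
    unfolding \<rho>_def by (rule integrable_gaussian_weighted[OF M dD(1) _ _ aR, where R = R]) (simp_all add: supp(1))
  have Lint: "integrable lborel (\<lambda>x. \<rho> x * M \<bar>u x\<bar>)"
    unfolding \<rho>_def by (rule integrable_gaussian_weighted[OF M dD(1) _ _ U(2), where R = R]) (simp_all add: supp(1))
  have Gint: "integrable lborel (\<lambda>x. \<rho> x * M (norm (g x)))"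
    unfolding \<rho>_def by (rule integrable_gaussian_weighted[OF M dD(1) _ _ F(2), where R = R]) (simp_all add: g0)
  note nn = condition_M_nonneg[OF M]

  have I2: "(\<integral>x. \<rho> x * (M (?a x) / (norm x)\<^sup>2) \<partial>lborel)
      \<le> (1 - 2 / D) * l\<^sup>2 * K + 2 / D * l powr (2 - D) * L"
  proof -
    let ?f = "\<lambda>x. (1 - 2 / D) * l\<^sup>2 * (\<rho> x * M (?a x)) + 2 / D * l powr (2 - D) * (\<rho> x * M \<bar>u x\<bar>)"
    have "(\<integral>x. \<rho> x * (M (?a x) / (norm x)\<^sup>2) \<partial>lborel) \<le> (\<integral>x. ?f x \<partial>lborel)"
    proof (rule integral_mono')
      show "integrable lborel ?f"
        using Kint Lint by simp
      fix x
      \<comment> \<open>If \<open>u x = 0\<close>, both sides vanish because \<open>M 0 = 0\<close>.\<close>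
      have "M (?a x) / (norm x)\<^sup>2 = M (?a x) * (\<bar>u x\<bar> / ?a x) powr 2"
        using condition_M_zero[OF M] by (cases "u x = 0") (auto simp: power2_eq_square)
      also have "\<dots> \<le> (1 - 2 / D) * l powr 2 * M (?a x) + 2 / D * l powr (2 - D) * M \<bar>u x\<bar>"
        using dD l by (intro condition_M_interpolation[OF M]) auto
      finally have "\<rho> x * (M (?a x) / (norm x)\<^sup>2)
          \<le> \<rho> x * ((1 - 2 / D) * l powr 2 * M (?a x) + 2 / D * l powr (2 - D) * M \<bar>u x\<bar>)"
        using \<rho> by (rule mult_left_mono)
      then show "\<rho> x * (M (?a x) / (norm x)\<^sup>2) \<le> ?f x"
        using l by (simp add: algebra_simps)
      show "0 \<le> ?f x"
        using dD \<rho>[of x] nn by simp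
    qed
    also have "\<dots> = (1 - 2 / D) * l\<^sup>2 * K + 2 / D * l powr (2 - D) * L"
      using Kint Lint unfolding K_def L_def
      by (subst Bochner_Integration.integral_add) (simp_all only: integral_mult_right_zero integrable_mult_right)
    finally show ?thesis .
  qed
  have I1: "(\<integral>x. \<rho> x * (M (?a x) / ?a x * norm (g x)) \<partial>lborel)
      \<le> (1 - 1 / D) * m * K + 1 / D * m powr (1 - D) * G"
  proof -
    let ?f = "\<lambda>x. (1 - 1 / D) * m * (\<rho> x * M (?a x)) + 1 / D * m powr (1 - D) * (\<rho> x * M (norm (g x)))"
    have "(\<integral>x. \<rho> x * (M (?a x) / ?a x * norm (g x)) \<partial>lborel) \<le> (\<integral>x. ?f x \<partial>lborel)"
    proof (rule integral_mono')
      show "integrable lborel ?f"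
        using Kint Gint by simp
      fix x
      have "M (?a x) / ?a x * norm (g x) = M (?a x) * (norm (g x) / ?a x) powr 1"
        by simp
      also have "\<dots> \<le> (1 - 1 / D) * m powr 1 * M (?a x) + 1 / D * m powr (1 - D) * M (norm (g x))"
        using dD m by (intro condition_M_interpolation[OF M]) auto
      finally have "\<rho> x * (M (?a x) / ?a x * norm (g x))
          \<le> \<rho> x * ((1 - 1 / D) * m powr 1 * M (?a x) + 1 / D * m powr (1 - D) * M (norm (g x)))"
        using \<rho> by (rule mult_left_mono)
      then show "\<rho> x * (M (?a x) / ?a x * norm (g x)) \<le> ?f x"
        using m by (simp add: algebra_simps)
      show "0 \<le> ?f x"
        using dD \<rho>[of x] nn m by simp
    qed
    also have "\<dots> = (1 - 1 / D) * m * K + 1 / D * m powr (1 - D) * G"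
      using Kint Gint unfolding K_def G_def
      by (subst Bochner_Integration.integral_add) (simp_all only: integral_mult_right_zero integrable_mult_right)
    finally show ?thesis .
  qed
  have "K \<le> (D + real DIM('a) - 2) * (\<integral>x. \<rho> x * (M (?a x) / (norm x)\<^sup>2) \<partial>lborel)
      + D * (\<integral>x. \<rho> x * (M (?a x) / ?a x * norm (g x)) \<partial>lborel)"
    unfolding K_def \<rho>_def using dD by (intro gaussian_dilation_inequality[OF M _ _ du g supp]) auto
  also have "\<dots> \<le> (D + real DIM('a) - 2) * ((1 - 2 / D) * l\<^sup>2 * K + 2 / D * l powr (2 - D) * L)
        + D * ((1 - 1 / D) * m * K + 1 / D * m powr (1 - D) * G)"
    using I1 I2 dD by (intro add_mono mult_left_mono) auto
  finally show ?thesis .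
qed

section \<open>The inequality for the standard Gaussian measure\<close>

lemma integral_std_gaussian:
  fixes f :: "real ^ 'n \<Rightarrow> real"
  assumes "f \<in> borel_measurable borel"
  shows "(\<integral>x. f x \<partial>std_gaussian) =
    (2 * pi) powr (- real CARD('n) / 2) * (\<integral>x. exp (- (norm x)\<^sup>2 / 2) * f x \<partial>lborel)"
proof -
  have "(\<integral>x. f x \<partial>std_gaussian) =
      (\<integral>x. ((2 * pi) powr (- real CARD('n) / 2) * exp (- (norm x)\<^sup>2 / 2)) *\<^sub>R f x \<partial>lborel)"
    unfolding std_gaussian_def using assms by (subst integral_density) auto
  then show ?thesis
    by (simp add: mult.assoc)
qed

theorem theorem3p2:
  fixes M :: "real \<Rightarrow> real"
    and d_M D_M :: real
    and u :: "real ^ 'n \<Rightarrow> real"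
  assumes "condition_M M d_M D_M"
    and "d_M \<ge> 2"
    and "D_M > max 2 (exp 1 + 2 - real CARD('n))"
    and "u \<in> C01"
  defines "\<K> \<equiv> (\<integral>x. M (norm x * \<bar>u x\<bar>) \<partial>std_gaussian)"
    and "\<L> \<equiv> (\<integral>x. M \<bar>u x\<bar> \<partial>std_gaussian)"
    and "\<M> \<equiv> (\<integral>x. M (norm (grad u x)) \<partial>std_gaussian)"
  shows "\<K> \<le> (1/2 * D_M * \<M> powr (1 / D_M)
               + sqrt (1/4 * D_M\<^sup>2 * \<M> powr (2 / D_M)
                       + (D_M + real CARD('n) - 2) * \<L> powr (2 / D_M))) powr D_M"
proof (rule optimise_scales)
  have du: "GDERIV u x :> grad u x" for x
    using assms(4) by (intro GDERIV_grad) (simp add: C01_def)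
  have g: "continuous_on UNIV (grad u)"
    using assms(4) by (simp add: C01_def)
  have "bounded (closure {x. u x \<noteq> 0})"
    using assms(4) by (intro compact_imp_bounded) (simp add: C01_def)
  then obtain R where R: "0 < R" "\<forall>x\<in>closure {x. u x \<noteq> 0}. norm x \<le> R"
    by (auto simp: bounded_pos)
  have supp: "u x = 0" if "R < norm x" for x
    using R(2) that closure_subset[of "{x. u x \<noteq> 0}"] by (fastforce simp: not_le[symmetric])
  have "continuous_on UNIV u"
    using du by (meson continuous_at_imp_continuous_on gderiv_def has_derivative_continuous)
  then have [measurable]: "u \<in> borel_measurable borel" "grad u \<in> borel_measurable borel"
    using g by (auto intro: borel_measurable_continuous_onI)
  have [measurable]: "(\<lambda>x. M (norm x * \<bar>u x\<bar>)) \<in> borel_measurable borel"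
    "(\<lambda>x. M \<bar>u x\<bar>) \<in> borel_measurable borel" "(\<lambda>x. M (norm (grad u x))) \<in> borel_measurable borel"
    by (rule condition_M_measurable[OF assms(1,2)]; simp)+
  show "2 < D_M" "exp 1 < D_M + real CARD('n) - 2"
    using assms(3) by auto
  show "0 \<le> \<K>" "0 \<le> \<L>" "0 \<le> \<M>"
    unfolding \<K>_def \<L>_def \<M>_def using condition_M_nonneg[OF assms(1)] by simp_all
  fix l m :: real
  assume lm: "0 < l" "0 < m" "l powr (D_M - 2) \<le> 2 / D_M" "m powr (D_M - 1) \<le> 1 / D_M"
  define c where "c = (2 * pi) powr (- real CARD('n) / 2)"
  define K L G where "K = (\<integral>x. exp (- (norm x)\<^sup>2 / 2) * M (norm x * \<bar>u x\<bar>) \<partial>lborel)"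
    and "L = (\<integral>x. exp (- (norm x)\<^sup>2 / 2) * M \<bar>u x\<bar> \<partial>lborel)"
    and "G = (\<integral>x. exp (- (norm x)\<^sup>2 / 2) * M (norm (grad u x)) \<partial>lborel)"
  have eq: "\<K> = c * K" "\<L> = c * L" "\<M> = c * G"
    unfolding \<K>_def \<L>_def \<M>_def K_def L_def G_def c_def by (simp_all add: integral_std_gaussian)
  \<comment> \<open>The inequality is homogeneous, so the normalising constant \<open>c\<close> can be put back afterwards.\<close>
  have "K \<le> (D_M + real DIM(real ^ 'n) - 2) *
        ((1 - 2 / D_M) * l\<^sup>2 * K + 2 / D_M * l powr (2 - D_M) * L)
      + D_M * ((1 - 1 / D_M) * m * K + 1 / D_M * m powr (1 - D_M) * G)"
    unfolding K_def L_def G_def using assms(3) lm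
    by (intro gaussian_scaled_inequality[OF assms(1,2) _ du g supp R(1)]) auto
  then have "c * K \<le> c * ((D_M + real CARD('n) - 2) *
        ((1 - 2 / D_M) * l\<^sup>2 * K + 2 / D_M * l powr (2 - D_M) * L)
      + D_M * ((1 - 1 / D_M) * m * K + 1 / D_M * m powr (1 - D_M) * G))"
    by (intro mult_left_mono) (simp_all add: c_def)
  then show "\<K> \<le> (D_M + real CARD('n) - 2) *
        ((1 - 2 / D_M) * l\<^sup>2 * \<K> + 2 / D_M * l powr (2 - D_M) * \<L>)
      + D_M * ((1 - 1 / D_M) * m * \<K> + 1 / D_M * m powr (1 - D_M) * \<M>)"
    unfolding eq by (simp only: distrib_left mult.left_commute[of c])
qed

end
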